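(* Fix an integer $k\ge 1$. For every integer $n\ge 0$, the number of partitions of $n$ satisfying condition (P) equals the number of partitions of $n$ satisfying condition (S), where: (P) every part is either a multiple of $3$ or congruent to $2$ or $4 \pmod{3k+3}$. (S) all of the following hold: - the difference between adjacent parts is never $1$; - if the difference between two adjacent parts is in $\{2,5,\dots,3k-4\}$, then the smaller of these parts is $\not\equiv 1 \pmod 3$; - if the difference between two adjacent parts is in $\{4,7,\dots,3k-2\}$, then the smaller of these parts is $\equiv 0 \pmod 3$; - (initial condition, given by a fictitious zero) no part is equal to $1$. Moreover, the generating function of the partitions satisfying (P) is the periodic infinite product $\prod_m (1-q^m)^{-1}$ over all $m\ge1$ with $3\mid m$ or $m\equiv 2,4\pmod{3k+3}$; and a partition satisfies (S) if and only if its conjugate satisfies the following condition (C): (C) all of the following hold: - no part appears exactly once; - if the frequency of a part belongs to $\{2,5,8,\dots,3k-4\}$, then the number of parts strictly greater than it is $\not\equiv 1\pmod 3$; - if the frequency of a part belongs to $\{4,7,10,\dots,3k-2\}$, then the number of parts strictly greater than it is $\equiv 0\pmod 3$.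
   Context: Partitions $\lambda=(\lambda_1\ge\lambda_2\ge\dots\ge\lambda_r)$ have positive integer parts; adjacent parts are $\lambda_i,\lambda_{i+1}$ for $1\le i<r$. The sets $\{2,5,\dots,3k-4\}$ and $\{4,7,\dots,3k-2\}$ are arithmetic progressions with common difference $3$ (both empty when $k=1$). The initial condition is "given by a fictitious zero" if it is what the difference conditions impose when one part equal to $0$ is appended to the partition. The frequency of a part is the number of times it occurs; numbers of parts are counted with multiplicity. The conjugate of a partition is obtained by transposing its Ferrers diagram. *)

theory Defs
  imports
    "HOL-Analysis.Infinite_Products"
    "HOL-Computational_Algebra.Formal_Power_Series"
    "HOL-Number_Theory.Cong"
begin

definition is_partition :: "nat list \<Rightarrow> bool" where
  "is_partition xs \<longleftrightarrow> sorted_wrt (\<ge>) xs \<and> (\<forall>x\<in>set xs. x > 0)"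

definition partitions_of :: "nat \<Rightarrow> nat list set" where
  "partitions_of n = {xs. is_partition xs \<and> sum_list xs = n}"

lemma finite_partitions_of: "finite (partitions_of n)"
proof (rule finite_subset)
  show "partitions_of n \<subseteq> {xs. set xs \<subseteq> {..n} \<and> length xs \<le> n}"
  proof
    fix xs assume "xs \<in> partitions_of n"
    then have pos: "\<forall>x\<in>set xs. x > 0" and n: "sum_list xs = n"
      by (auto simp: partitions_of_def is_partition_def)
    have "length xs \<le> sum_list xs"
      using pos by (induction xs) auto
    then show "xs \<in> {xs. set xs \<subseteq> {..n} \<and> length xs \<le> n}"
      using n member_le_sum_list by auto
  qed
  show "finite {xs. set xs \<subseteq> {..n} \<and> length xs \<le> n}"
    by (rule finite_lists_length_le) simp
qed


subsection \<open>Conjugation\<close>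

definition ferrers :: "nat list \<Rightarrow> (nat \<times> nat) set" where
  "ferrers xs = {(i, j). i < length xs \<and> j < xs ! i}"

text \<open>The transpose of a diagram, as a set of pairs, is its converse as a relation.\<close>

definition conjugate :: "nat list \<Rightarrow> nat list" where
  "conjugate xs = (THE ys. is_partition ys \<and> ferrers ys = (ferrers xs)\<inverse>)"

lemma ferrers_inj:
  assumes "is_partition xs" "is_partition ys" "ferrers xs = ferrers ys"
  shows "xs = ys"
proof -
  have iff: "(i < length xs \<and> j < xs ! i) \<longleftrightarrow> (i < length ys \<and> j < ys ! i)" for i j
    using assms(3) by (auto simp: ferrers_def set_eq_iff)
  have px: "0 < xs ! i" if "i < length xs" for i
    using assms(1) that by (auto simp: is_partition_def)
  have py: "0 < ys ! i" if "i < length ys" for i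
    using assms(2) that by (auto simp: is_partition_def)
  have len: "i < length xs \<longleftrightarrow> i < length ys" for i
    using iff[of i 0] px[of i] py[of i] by blast
  have eq: "length xs = length ys"
    using len[of "length xs"] len[of "length ys"] by auto
  show ?thesis
  proof (rule nth_equalityI[OF eq])
    fix i assume i: "i < length xs"
    then have "j < xs ! i \<longleftrightarrow> j < ys ! i" for j
      using iff[of i j] eq by auto
    from this[of "xs ! i"] this[of "ys ! i"] show "xs ! i = ys ! i"
      by auto
  qed
qed

lemma conjugate_exists:
  assumes "is_partition xs"
  shows "\<exists>ys. is_partition ys \<and> ferrers ys = (ferrers xs)\<inverse>"
proof -
  define c where "c j = card {i. i < length xs \<and> j < xs ! i}" for j
  define m where "m = (if xs = [] then 0 else xs ! 0)"
  define ys where "ys = map c [0..<m]"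
  have mono: "xs ! i' \<le> xs ! i" if "i \<le> i'" "i' < length xs" for i i'
    using assms that by (cases "i = i'") (auto simp: is_partition_def sorted_wrt_iff_nth_less)
  have col: "i < c j \<longleftrightarrow> i < length xs \<and> j < xs ! i" for i j
  proof
    assume *: "i < length xs \<and> j < xs ! i"
    then have "{..i} \<subseteq> {i. i < length xs \<and> j < xs ! i}"
      using mono by (auto intro: less_le_trans)
    then have "card {..i} \<le> c j"
      unfolding c_def by (intro card_mono) auto
    then show "i < c j" by simp
  next
    assume *: "i < c j"
    show "i < length xs \<and> j < xs ! i"
    proof (rule ccontr)
      assume n: "\<not> (i < length xs \<and> j < xs ! i)"
      have "{i. i < length xs \<and> j < xs ! i} \<subseteq> {..<i}"
      proof
        fix l assume l: "l \<in> {i. i < length xs \<and> j < xs ! i}"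
        show "l \<in> {..<i}"
        proof (rule ccontr)
          assume "l \<notin> {..<i}"
          then have "i \<le> l" by simp
          with l mono[of i l] n show False by auto
        qed
      qed
      then have "c j \<le> card {..<i}"
        unfolding c_def by (intro card_mono) auto
      with * show False by simp
    qed
  qed
  have m: "j < m" if "i < length xs" "j < xs ! i" for i j
    using that mono[of 0 i] by (auto simp: m_def split: if_splits)
  have "ferrers ys = (ferrers xs)\<inverse>"
    using col m by (auto simp: ferrers_def ys_def)
  moreover have "sorted_wrt (\<ge>) ys"
  proof -
    have "c j' \<le> c j" if "j \<le> j'" for j j'
      unfolding c_def using that by (intro card_mono) auto
    then show ?thesis
      by (auto simp: ys_def sorted_wrt_iff_nth_less)
  qed
  moreover have "\<forall>y\<in>set ys. y > 0"
    using col by (auto simp: ys_def m_def split: if_splits)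
  ultimately show ?thesis
    by (auto simp: is_partition_def)
qed

lemma conjugate:
  assumes "is_partition xs"
  shows "is_partition (conjugate xs) \<and> ferrers (conjugate xs) = (ferrers xs)\<inverse>"
  unfolding conjugate_def
  by (rule theI') (use conjugate_exists[OF assms] ferrers_inj in metis)


subsection \<open>Conditions (P), (S) and (C)\<close>

definition allowed_part :: "nat \<Rightarrow> nat \<Rightarrow> bool" where
  "allowed_part k m \<longleftrightarrow> 3 dvd m \<or> [m = 2] (mod (3*k+3)) \<or> [m = 4] (mod (3*k+3))"

definition cond_P :: "nat \<Rightarrow> nat list \<Rightarrow> bool" where
  "cond_P k xs \<longleftrightarrow> (\<forall>x\<in>set xs. allowed_part k x)"

text \<open>For \<open>k \<ge> 1\<close> these are the progressions 2, 5, ..., 3k-4 and 4, 7, ..., 3k-2,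
  with k-1 terms each.\<close>

definition diffs2 :: "nat \<Rightarrow> nat set" where
  "diffs2 k = (\<lambda>j. 3 * j + 2) ` {..<k - 1}"

definition diffs4 :: "nat \<Rightarrow> nat set" where
  "diffs4 k = (\<lambda>j. 3 * j + 4) ` {..<k - 1}"

definition diff_conds :: "nat \<Rightarrow> nat list \<Rightarrow> bool" where
  "diff_conds k xs \<longleftrightarrow>
     (\<forall>i. Suc i < length xs \<longrightarrow>
        xs ! i - xs ! Suc i \<noteq> 1 \<and>
        (xs ! i - xs ! Suc i \<in> diffs2 k \<longrightarrow> \<not> [xs ! Suc i = 1] (mod 3)) \<and>
        (xs ! i - xs ! Suc i \<in> diffs4 k \<longrightarrow> [xs ! Suc i = 0] (mod 3)))"

definition cond_S :: "nat \<Rightarrow> nat list \<Rightarrow> bool" where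
  "cond_S k xs \<longleftrightarrow> diff_conds k xs \<and> 1 \<notin> set xs"

text \<open>The initial condition is indeed what the difference conditions impose when a
  fictitious part 0 is appended.\<close>

lemma cond_S_fictitious_zero:
  assumes "is_partition xs"
  shows "cond_S k xs \<longleftrightarrow> diff_conds k (xs @ [0])"
proof (cases xs rule: rev_cases)
  case Nil
  then show ?thesis by (simp add: cond_S_def diff_conds_def)
next
  case (snoc zs z)
  have ge: "\<forall>x\<in>set zs. z \<le> x" and z: "z > 0"
    using assms snoc by (auto simp: is_partition_def sorted_wrt_append)
  have one: "1 \<in> set xs \<longleftrightarrow> z = 1"
    using ge z assms snoc by (fastforce simp: is_partition_def)
  have nth: "(xs @ [0]) ! i = xs ! i" if "i < length xs" for i
    using that by (simp add: nth_append)
  have split: "(\<forall>i. Suc i < length (xs @ [0]) \<longrightarrow> Q i) \<longleftrightarrow>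
      (\<forall>i. Suc i < length xs \<longrightarrow> Q i) \<and> Q (length zs)" for Q
    using snoc by (auto simp: less_Suc_eq)
  have last: "(xs @ [0]) ! length zs = z" "(xs @ [0]) ! Suc (length zs) = 0"
    using snoc by (simp_all add: nth_append)
  show ?thesis
    unfolding cond_S_def diff_conds_def split last one
    by (auto simp: nth cong_def)
qed

definition cond_C :: "nat \<Rightarrow> nat list \<Rightarrow> bool" where
  "cond_C k xs \<longleftrightarrow>
     (\<forall>x\<in>set xs.
        count_list xs x \<noteq> 1 \<and>
        (count_list xs x \<in> diffs2 k \<longrightarrow> \<not> [length (filter (\<lambda>y. y > x) xs) = 1] (mod 3)) \<and>
        (count_list xs x \<in> diffs4 k \<longrightarrow> [length (filter (\<lambda>y. y > x) xs) = 0] (mod 3)))"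

definition gf_P :: "nat \<Rightarrow> rat fps" where
  "gf_P k = Abs_fps (\<lambda>n. of_nat (card {xs \<in> partitions_of n. cond_P k xs}))"

end

theory Submission
  imports Defs "HOL-Library.Multiset"
begin

text \<open>
  Write \<open>K = 3 * k + 3\<close>. The numbers 0, 4, 2 represent the residue classes 0, 1, 2 modulo 3, and
  (S) says precisely the following (\<open>step_3_iff\<close>): if two adjacent parts, the larger first, are
  congruent modulo 3 to \<open>r\<close> and \<open>s\<close> in \<open>{0, 2, 4}\<close>, then their difference is at least the least
  nonnegative residue of \<open>r - s\<close> modulo \<open>K\<close>. For instance, from a part congruent to 1 one cannot
  go up by less than \<open>K - 4 = 3 * k - 1\<close> to a part divisible by 3, because \<open>r - s = 0 - 4\<close>.

  Call a partition flat if its parts are congruent to 0, 2 or 4 modulo \<open>K\<close> and its adjacent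
  differences, including the one between the smallest part and a fictitious zero, are less than
  \<open>K\<close>. The differences of a flat partition are exactly these least residues, so each
  partition with (S) is in a unique way the partwise sum of a flat partition and a partition into
  multiples of 3. In the same way, each partition into parts congruent to 0, 2, 4 modulo
  \<open>K\<close> is in a unique way the sum of a flat partition and a partition into multiples of \<open>K\<close>.
  Both decompositions are instances of \<open>gf_split\<close>, for the divisors 3 and \<open>K\<close> of \<open>K\<close>.

  By the second one, \<open>A * D = F * D\<close>, where \<open>F\<close>, \<open>D\<close> and \<open>A\<close> count the flat partitions, the
  partitions into multiples of \<open>K\<close>, and those into parts congruent to 2 or 4 modulo \<open>K\<close>.
  Hence \<open>F = A\<close>. By the first one, the series of (S) is \<open>F * T = A * T\<close>, where \<open>T\<close> counts the
  partitions into multiples of 3, and \<open>A * T\<close> is the series of (P).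

  As for conjugation: the number of parts of the conjugate that exceed \<open>v\<close> is the part of the
  original partition with (zero-based) index \<open>v\<close>, so frequencies in the conjugate are differences
  of adjacent parts, and (S) is (C) read off the transposed diagram.
\<close>

section \<open>Counting series of weighted sets\<close>

definition gf :: "('a \<Rightarrow> nat) \<Rightarrow> 'a set \<Rightarrow> rat fps" where
  "gf w X = Abs_fps (\<lambda>n. of_nat (card {x \<in> X. w x = n}))"

lemma gf_bij:
  assumes bij: "bij_betw f X Y" and w: "\<And>x. x \<in> X \<Longrightarrow> v (f x) = w x"
  shows "gf w X = gf v Y"
proof -
  have "card {x \<in> X. w x = n} = card {y \<in> Y. v y = n}" for n
  proof (rule bij_betw_same_card)
    show "bij_betw f {x \<in> X. w x = n} {y \<in> Y. v y = n}"
      using bij w unfolding bij_betw_def inj_on_def by auto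
  qed
  then show ?thesis by (simp add: gf_def)
qed

lemma gf_Times:
  assumes fX: "\<And>n. finite {x \<in> X. w x = n}" and fY: "\<And>n. finite {y \<in> Y. v y = n}"
  shows "gf (\<lambda>(x, y). w x + v y) (X \<times> Y) = gf w X * gf v Y"
proof (rule fps_ext)
  fix n
  let ?A = "\<lambda>i. {x \<in> X. w x = i} \<times> {y \<in> Y. v y = n - i}"
  have "{p \<in> X \<times> Y. (case p of (x, y) \<Rightarrow> w x + v y) = n} = (\<Union>i\<in>{0..n}. ?A i)"
    by auto
  also have "card \<dots> = (\<Sum>i=0..n. card (?A i))"
    using fX fY by (intro card_UN_disjoint) auto
  finally show "fps_nth (gf (\<lambda>(x, y). w x + v y) (X \<times> Y)) n = fps_nth (gf w X * gf v Y) n"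
    by (simp add: gf_def fps_mult_nth card_cartesian_product)
qed

lemma gf_bij_Times:
  assumes "\<And>n. finite {x \<in> X. w x = n}" "\<And>n. finite {y \<in> Y. v y = n}"
    and "bij_betw f (X \<times> Y) Z"
    and "\<And>x y. x \<in> X \<Longrightarrow> y \<in> Y \<Longrightarrow> u (f (x, y)) = w x + v y"
  shows "gf u Z = gf w X * gf v Y"
proof -
  have "gf (\<lambda>(x, y). w x + v y) (X \<times> Y) = gf u Z"
    using assms(3,4) by (intro gf_bij[of f]) auto
  then show ?thesis using gf_Times[OF assms(1,2)] by simp
qed

section \<open>Partitions with parts in a given set\<close>

definition Parts :: "nat set \<Rightarrow> nat list set" where
  "Parts A = {xs. is_partition xs \<and> set xs \<subseteq> A}"

abbreviation gf_Parts :: "nat set \<Rightarrow> rat fps" where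
  "gf_Parts A \<equiv> gf sum_list (Parts A)"

lemma finite_Parts_level: "finite {xs \<in> Parts A. sum_list xs = n}"
  by (rule finite_subset[OF _ finite_partitions_of[of n]]) (auto simp: Parts_def partitions_of_def)

lemma is_partition_mset_eq:
  assumes "is_partition xs" "is_partition ys" "mset xs = mset ys"
  shows "xs = ys"
proof -
  have s: "sorted (rev xs)" "sorted (rev ys)"
    using assms(1,2) by (simp_all add: is_partition_def sorted_wrt_rev)
  have "rev xs = rev ys"
    using s assms(3) properties_for_sort[of "rev xs" "rev ys"] sorted_sort_id[of "rev ys"]
    by (metis mset_rev)
  then show ?thesis by simp
qed

lemma is_partition_filter: "is_partition xs \<Longrightarrow> is_partition (filter P xs)"
  by (auto simp: is_partition_def sorted_wrt_filter)

text \<open>A partition with parts in a disjoint union is determined by its two subpartitions, and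
  any two can be merged by sorting.\<close>

lemma gf_Parts_Un:
  assumes disj: "A \<inter> B = {}"
  shows "gf_Parts (A \<union> B) = gf_Parts A * gf_Parts B"
proof -
  let ?m = "\<lambda>(ys, zs). rev (sort (ys @ zs))"
  have part: "is_partition (rev (sort (ys @ zs)))" if "is_partition ys" "is_partition zs" for ys zs
    using that by (auto simp: is_partition_def sorted_wrt_rev)
  have fltA: "filter (\<lambda>x. x \<in> A) (rev (sort (ys @ zs))) = ys"
    and fltB: "filter (\<lambda>x. x \<in> B) (rev (sort (ys @ zs))) = zs"
    if "ys \<in> Parts A" "zs \<in> Parts B" for ys zs
  proof -
    have "filter (\<lambda>x. x \<in> A) zs = []" "filter (\<lambda>x. x \<in> A) ys = ys"
      "filter (\<lambda>x. x \<in> B) ys = []" "filter (\<lambda>x. x \<in> B) zs = zs"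
      using that disj by (auto simp: Parts_def filter_empty_conv filter_id_conv)
    then have "mset (filter (\<lambda>x. x \<in> A) (ys @ zs)) = mset ys"
      "mset (filter (\<lambda>x. x \<in> B) (ys @ zs)) = mset zs"
      by simp_all
    then show "filter (\<lambda>x. x \<in> A) (rev (sort (ys @ zs))) = ys"
      "filter (\<lambda>x. x \<in> B) (rev (sort (ys @ zs))) = zs"
      using that part[of ys zs]
      by (auto intro!: is_partition_mset_eq is_partition_filter simp: Parts_def mset_filter)
  qed
  have mer: "rev (sort (filter (\<lambda>x. x \<in> A) xs @ filter (\<lambda>x. x \<in> B) xs)) = xs"
    if "xs \<in> Parts (A \<union> B)" for xs
  proof (rule is_partition_mset_eq)
    have "filter_mset (\<lambda>x. x \<in> B) (mset xs) = filter_mset (\<lambda>x. x \<notin> A) (mset xs)"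
      using that disj by (intro filter_mset_cong) (auto simp: Parts_def)
    then show "mset (rev (sort (filter (\<lambda>x. x \<in> A) xs @ filter (\<lambda>x. x \<in> B) xs))) = mset xs"
      by (simp add: mset_filter multiset_partition[symmetric])
  qed (use that in \<open>auto simp: Parts_def intro!: part is_partition_filter\<close>)
  have "bij_betw ?m (Parts A \<times> Parts B) (Parts (A \<union> B))"
  proof (rule bij_betw_byWitness)
    let ?f = "\<lambda>xs. (filter (\<lambda>x. x \<in> A) xs, filter (\<lambda>x. x \<in> B) xs)"
    show "\<forall>p\<in>Parts A \<times> Parts B. ?f (?m p) = p"
      using fltA fltB by auto
    show "\<forall>xs\<in>Parts (A \<union> B). ?m (?f xs) = xs"
      using mer by auto
    show "?m ` (Parts A \<times> Parts B) \<subseteq> Parts (A \<union> B)"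
      using part by (auto simp: Parts_def)
    show "?f ` Parts (A \<union> B) \<subseteq> Parts A \<times> Parts B"
      by (auto simp: Parts_def is_partition_filter)
  qed
  moreover have "sum_list (?m (ys, zs)) = sum_list ys + sum_list zs" for ys zs :: "nat list"
    by (simp flip: sum_mset_sum_list)
  ultimately show ?thesis
    by (intro gf_bij_Times[of _ sum_list _ sum_list ?m] finite_Parts_level)
qed

lemma gf_Parts_singleton:
  assumes "m > 0"
  shows "gf_Parts {m} = inverse (1 - fps_X ^ m)"
proof -
  have "bij_betw (\<lambda>j. replicate j m) UNIV (Parts {m})"
  proof (rule bij_betw_byWitness[where f' = length])
    show "\<forall>xs\<in>Parts {m}. replicate (length xs) m = xs"
      by (auto simp: Parts_def intro: replicate_eqI[symmetric])
    show "range (\<lambda>j. replicate j m) \<subseteq> Parts {m}"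
      using assms by (auto simp: Parts_def is_partition_def sorted_wrt_iff_nth_less)
  qed auto
  then have "gf_Parts {m} = gf (\<lambda>j. j * m) UNIV"
    by (intro gf_bij[symmetric]) (auto simp: sum_list_replicate)
  also have "\<dots> = Abs_fps (\<lambda>n. if m dvd n then 1 else 0)"
  proof -
    have "card {j. j * m = n} = (if m dvd n then 1 else 0)" for n
    proof (cases "m dvd n")
      case True
      then have "{j. j * m = n} = {n div m}" using assms by auto
      then show ?thesis using True by simp
    next
      case False
      then have "{j. j * m = n} = {}" by auto
      then show ?thesis using False by simp
    qed
    then show ?thesis unfolding gf_def by (intro fps_ext) simp
  qed
  finally have g: "gf_Parts {m} = Abs_fps (\<lambda>n. if m dvd n then 1 else 0)" .
  have "(1 - fps_X ^ m) * gf_Parts {m} = 1"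
  proof (rule fps_ext)
    fix n
    have "fps_nth ((1 - fps_X ^ m) * gf_Parts {m}) n =
        fps_nth (gf_Parts {m}) n - fps_nth (fps_X ^ m * gf_Parts {m}) n"
      by (simp add: algebra_simps)
    also have "\<dots> = fps_nth 1 n"
      using assms by (auto simp: fps_X_power_mult_nth g nat_dvd_not_less dvd_minus_self)
    finally show "fps_nth ((1 - fps_X ^ m) * gf_Parts {m}) n = fps_nth 1 n" .
  qed
  then show ?thesis by (rule fps_inverse_unique[symmetric])
qed

lemma gf_Parts_prod:
  assumes "finite A" "0 \<notin> A"
  shows "gf_Parts A = (\<Prod>m\<in>A. inverse (1 - fps_X ^ m))"
  using assms
proof (induction A rule: finite_induct)
  case empty
  have "Parts {} = {[]}" by (auto simp: Parts_def is_partition_def)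
  then have "gf_Parts {} = 1" by (intro fps_ext) (auto simp: gf_def fps_one_nth card_eq_0_iff cong: conj_cong)
  then show ?case by simp
next
  case (insert m A)
  then show ?case
    using gf_Parts_Un[of "{m}" A] gf_Parts_singleton[of m] by simp
qed

lemma gf_Parts_0: "fps_nth (gf_Parts A) 0 = 1"
proof -
  have "{xs \<in> Parts A. sum_list xs = 0} = {[]}"
    by (auto simp: Parts_def is_partition_def) (metis length_greater_0_conv nth_mem less_irrefl)
  then show ?thesis by (simp add: gf_def)
qed

lemma gf_Parts_nonzero: "gf_Parts A \<noteq> 0"
  using gf_Parts_0[of A] by auto

text \<open>Coefficient \<open>n\<close> only sees parts up to \<open>n\<close>, so the partial products, which count
  partitions with bounded parts, stabilise coefficientwise.\<close>

lemma gf_Parts_has_prod: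
  "(\<lambda>m. if Suc m \<in> A then inverse (1 - fps_X ^ Suc m) else 1) has_prod gf_Parts A"
    (is "?f has_prod _")
proof -
  have "fps_nth (\<Prod>i\<le>N. ?f i) n = fps_nth (gf_Parts A) n" if "n \<le> N" for n N
  proof -
    let ?B = "A \<inter> {1..Suc N}"
    have "(\<Prod>i\<le>N. ?f i) = (\<Prod>m\<in>{1..Suc N}. if m \<in> A then inverse (1 - fps_X ^ m) else 1)"
      by (rule prod.reindex_bij_witness[of _ "\<lambda>m. m - 1" Suc]) auto
    also have "\<dots> = (\<Prod>m\<in>{1..Suc N} \<inter> A. inverse (1 - fps_X ^ m))"
      by (rule prod.inter_restrict[symmetric]) simp
    also have "\<dots> = gf_Parts ?B"
      by (subst gf_Parts_prod) (auto simp: Int_commute)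
    also have "fps_nth (gf_Parts ?B) n = fps_nth (gf_Parts A) n"
    proof -
      have "set xs \<subseteq> {1..Suc N}" if "is_partition xs" "sum_list xs = n" for xs
        using that \<open>n \<le> N\<close> member_le_sum_list[of _ xs] by (force simp: is_partition_def)
      then have "{xs \<in> Parts ?B. sum_list xs = n} = {xs \<in> Parts A. sum_list xs = n}"
        by (auto simp: Parts_def)
      then show ?thesis by (simp add: gf_def)
    qed
    finally show ?thesis .
  qed
  then have "(\<lambda>N. \<Prod>i\<le>N. ?f i) \<longlonglongrightarrow> gf_Parts A"
    by (intro tendsto_fpsI) (auto simp: eventually_sequentially)
  then show ?thesis
    using gf_Parts_nonzero by (simp add: has_prod_def raw_has_prod_def cong: if_cong)
qed

section \<open>Partitions as sequences\<close>

text \<open>Partwise addition needs partitions of different lengths to be aligned, and the smallest part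
  to be compared with a fictitious zero. Both come for free when a partition is continued by
  zeros to an infinite sequence.\<close>

definition pad :: "nat list \<Rightarrow> nat \<Rightarrow> nat" where
  "pad xs i = (if i < length xs then xs ! i else 0)"

definition Seqs :: "(nat \<Rightarrow> nat) set" where
  "Seqs = {f. antimono f \<and> (\<exists>N. \<forall>i\<ge>N. f i = 0)}"

definition weight :: "(nat \<Rightarrow> nat) \<Rightarrow> nat" where
  "weight f = (\<Sum>i | f i \<noteq> 0. f i)"

lemma weight_eq:
  assumes "\<forall>i\<ge>N. f i = 0"
  shows "weight f = (\<Sum>i<N. f i)"
  unfolding weight_def
  by (rule sum.mono_neutral_left) (use assms in \<open>auto simp: not_less[symmetric]\<close>)

lemma weight_add:
  assumes "f \<in> Seqs" "g \<in> Seqs"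
  shows "weight (\<lambda>i. f i + g i) = weight f + weight g"
proof -
  obtain M N where "\<forall>i\<ge>M. f i = 0" "\<forall>i\<ge>N. g i = 0"
    using assms by (auto simp: Seqs_def)
  then have "\<forall>i\<ge>max M N. f i = 0" "\<forall>i\<ge>max M N. g i = 0" by auto
  then show ?thesis
    using weight_eq[of "max M N" f] weight_eq[of "max M N" g]
      weight_eq[of "max M N" "\<lambda>i. f i + g i"] by (simp add: sum.distrib)
qed

lemma weight_pad: "weight (pad xs) = sum_list xs"
  by (subst weight_eq[of "length xs"])
    (auto simp: pad_def sum_list_sum_nth atLeast0LessThan intro!: sum.cong)

lemma pad_antimono:
  assumes "is_partition xs" "i \<le> j"
  shows "pad xs j \<le> pad xs i"
  using assms by (cases "i = j") (auto simp: pad_def is_partition_def sorted_wrt_iff_nth_less)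

lemma pad_bij: "bij_betw pad {xs. is_partition xs} Seqs"
  unfolding bij_betw_def
proof
  show "inj_on pad {xs. is_partition xs}"
  proof (rule inj_onI, clarify)
    fix xs ys assume "is_partition xs" "is_partition ys" "pad xs = pad ys"
    moreover have "ferrers zs = {(i, j). j < pad zs i}" for zs
      by (auto simp: ferrers_def pad_def split: if_splits)
    ultimately show "xs = ys" using ferrers_inj by metis
  qed
  show "pad ` {xs. is_partition xs} = Seqs"
  proof
    show "pad ` {xs. is_partition xs} \<subseteq> Seqs"
    proof clarify
      fix xs assume "is_partition xs"
      moreover have "\<forall>i\<ge>length xs. pad xs i = 0" by (simp add: pad_def)
      ultimately show "pad xs \<in> Seqs"
        using pad_antimono unfolding Seqs_def antimono_def by blast
    qed
    show "Seqs \<subseteq> pad ` {xs. is_partition xs}"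
    proof
      fix f assume "f \<in> Seqs"
      then have anti: "\<And>i j. i \<le> j \<Longrightarrow> f j \<le> f i" and ex: "\<exists>N. f N = 0"
        by (auto simp: Seqs_def antimono_def)
      define N where "N = (LEAST N. f N = 0)"
      have N: "f N = 0" "\<And>i. i < N \<Longrightarrow> f i > 0"
        unfolding N_def using ex by (auto intro: LeastI_ex dest: not_less_Least)
      have "f i = 0" if "i \<ge> N" for i
        using anti[OF that] N by simp
      then have "f = pad (map f [0..<N])"
        by (auto simp: pad_def fun_eq_iff)
      moreover have "is_partition (map f [0..<N])"
        using anti N by (auto simp: is_partition_def sorted_wrt_iff_nth_less)
      ultimately show "f \<in> pad ` {xs. is_partition xs}" by blast
    qed
  qed
qed

lemma gf_pad: "gf sum_list {xs. is_partition xs \<and> P (pad xs)} = gf weight {f \<in> Seqs. P f}"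
proof (rule gf_bij)
  show "bij_betw pad {xs. is_partition xs \<and> P (pad xs)} {f \<in> Seqs. P f}"
    using pad_bij unfolding bij_betw_def inj_on_def by auto
qed (rule weight_pad)

lemma finite_Seqs_level: "finite {f \<in> Seqs. weight f = n}"
proof -
  have "{f \<in> Seqs. weight f = n} \<subseteq> pad ` partitions_of n"
    using pad_bij weight_pad by (fastforce simp: bij_betw_def partitions_of_def)
  then show ?thesis using finite_partitions_of finite_surj by blast
qed

lemma all_pad_iff:
  assumes "P 0"
  shows "(\<forall>i. P (pad xs i)) \<longleftrightarrow> (\<forall>x\<in>set xs. P x)"
proof
  assume *: "\<forall>i. P (pad xs i)"
  have "P (xs ! i)" if "i < length xs" for i
    using spec[OF *, of i] that by (simp add: pad_def)
  then show "\<forall>x\<in>set xs. P x" by (auto simp: in_set_conv_nth)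
qed (use assms in \<open>simp add: pad_def\<close>)

lemma gf_Parts_eq_Seqs:
  assumes "P 0"
  shows "gf_Parts {m. P m} = gf weight {f \<in> Seqs. \<forall>i. P (f i)}"
proof -
  have "Parts {m. P m} = {xs. is_partition xs \<and> (\<forall>i. P (pad xs i))}"
    using all_pad_iff[of P, OF assms] by (auto simp: Parts_def)
  then show ?thesis using gf_pad[of "\<lambda>f. \<forall>i. P (f i)"] by simp
qed

section \<open>Splitting off multiples of a divisor of the modulus\<close>

text \<open>The condition at the last nonzero entry bounds it by \<open>K\<close>: this is the comparison with the
  fictitious zero.\<close>

definition Flat :: "nat \<Rightarrow> nat set \<Rightarrow> (nat \<Rightarrow> nat) set" where
  "Flat K R = {f \<in> Seqs. \<forall>i. f i mod K \<in> R \<and> f i < f (Suc i) + K}"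

text \<open>The bound on \<open>a - b\<close> is the least residue of \<open>r - s\<close> modulo \<open>K\<close>, for representatives in
  \<open>R\<close> of the classes modulo \<open>c\<close>; the summand \<open>K\<close> avoids a truncated subtraction.\<close>

definition step :: "nat \<Rightarrow> nat set \<Rightarrow> nat \<Rightarrow> nat \<Rightarrow> nat \<Rightarrow> bool" where
  "step K R c a b \<longleftrightarrow>
     (\<exists>r\<in>R. \<exists>s\<in>R. [a = r] (mod c) \<and> [b = s] (mod c) \<and> b + (r + K - s) mod K \<le> a)"

lemma Seqs_add: "f \<in> Seqs \<Longrightarrow> g \<in> Seqs \<Longrightarrow> (\<lambda>i. f i + g i) \<in> Seqs"
proof -
  assume a: "f \<in> Seqs" "g \<in> Seqs"
  then obtain M N where "\<forall>i\<ge>M. f i = 0" "\<forall>i\<ge>N. g i = 0"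
    by (auto simp: Seqs_def)
  then have "\<forall>i\<ge>max M N. f i + g i = 0" by auto
  then show ?thesis using a unfolding Seqs_def antimono_def
    by (auto intro: add_mono exI[of _ "max M N"])
qed

lemma SeqsI:
  assumes "\<And>i. f (Suc i) \<le> f i" "\<And>i. i \<ge> N \<Longrightarrow> f i = 0"
  shows "f \<in> Seqs"
  using assms decseq_Suc_iff[of f] unfolding Seqs_def antimono_def by auto

lemma diff_of_residues:
  fixes x y K :: nat
  assumes "K > 0" "y \<le> x"
  shows "(x mod K + K - y mod K) mod K = (x - y) mod K"
proof -
  have "int ((x mod K + K - y mod K) mod K) = (int x mod int K + int K - int y mod int K) mod int K"
    using assms mod_less_divisor[of K y]
    by (simp add: zmod_int of_nat_diff less_imp_le trans_le_add2)
  also have "\<dots> = (int x - int y) mod int K"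
    by (metis add.commute add_diff_eq mod_add_self1 mod_diff_eq)
  also have "\<dots> = int ((x - y) mod K)"
    using assms by (simp add: zmod_int of_nat_diff)
  finally show ?thesis by linarith
qed

text \<open>The heart of the argument. Adding a weakly decreasing sequence of multiples of \<open>c\<close>
  to a flat sequence does not change classes modulo \<open>c\<close> and cannot decrease differences, so
  the sum obeys \<open>step\<close>. Conversely, the classes modulo \<open>c\<close> of a sequence obeying \<open>step\<close> determine, by
  injectivity, the residues in \<open>R\<close> of the flat summand modulo \<open>K\<close>; since its
  differences are less than \<open>K\<close>, they are determined too, and summing them up from infinity
  gives the flat summand.\<close>

lemma gf_split:
  assumes K: "c dvd K" "K > 0" and R: "0 \<in> R" "R \<subseteq> {..<K}"
    and inj: "inj_on (\<lambda>r. r mod c) R"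
  shows "gf weight {f \<in> Seqs. \<forall>i. step K R c (f i) (f (Suc i))}
    = gf weight (Flat K R) * gf_Parts {m. c dvd m}"
proof -
  let ?Y = "{g \<in> Seqs. \<forall>i. c dvd g i}"
  let ?Z = "{f \<in> Seqs. \<forall>i. step K R c (f i) (f (Suc i))}"
  let ?add = "\<lambda>(f, g). (\<lambda>i. f i + g i :: nat)"
  have Rmod: "r = s" if "r \<in> R" "s \<in> R" "[r = s] (mod c)" for r s
    using inj that by (auto simp: inj_on_def cong_def)
  have Rself: "r mod K = r" if "r \<in> R" for r using R that by auto
  have flat_diff: "f i = f (Suc i) + (f i mod K + K - f (Suc i) mod K) mod K"
    if "f \<in> Flat K R" for f i
  proof -
    have "f (Suc i) \<le> f i" "f i < f (Suc i) + K"
      using that by (auto simp: Flat_def Seqs_def antimono_def)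
    then show ?thesis using diff_of_residues[OF K(2), of "f (Suc i)" "f i"] by simp
  qed
  have modc: "[f mod K = f] (mod c)" for f
    using K by (auto simp: cong_def mod_mod_cancel)
  have addc: "[f + g = f mod K] (mod c)" if "c dvd g" for f g
    using modc[of f] that by (auto simp: cong_def mod_add_eq dvd_eq_mod_eq_0 mod_mod_cancel elim!: dvdE)
  have "bij_betw ?add (Flat K R \<times> ?Y) ?Z"
    unfolding bij_betw_def
  proof
    show "inj_on ?add (Flat K R \<times> ?Y)"
    proof (rule inj_onI, clarify)
      fix f g f' g'
      assume f: "f \<in> Flat K R" "f' \<in> Flat K R"
        and g: "\<forall>i. c dvd g i" "\<forall>i. c dvd g' i"
        and eq: "(\<lambda>i. f i + g i) = (\<lambda>i. f' i + g' i)"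
      have m: "f i mod K = f' i mod K" for i
      proof (rule Rmod)
        have "c dvd g i" "c dvd g' i" using g by auto
        then show "[f i mod K = f' i mod K] (mod c)"
          using addc[of "g i" "f i"] addc[of "g' i" "f' i"] fun_cong[OF eq, of i]
          by (metis cong_sym cong_trans)
      qed (use f in \<open>auto simp: Flat_def\<close>)
      obtain M M' where M: "\<forall>i\<ge>M. f i = 0" "\<forall>i\<ge>M'. f' i = 0"
        using f by (auto simp: Flat_def Seqs_def)
      \<comment> \<open>Residues fix the differences, so equality spreads down from where both vanish.\<close>
      have ff: "f i = f' i" if "i \<le> max M M'" for i
        using that
      proof (induction i rule: inc_induct)
        case base then show ?case using M by simp
      next
        case (step i)
        then show ?case using flat_diff[OF f(1), of i] flat_diff[OF f(2), of i] m by metis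
      qed
      have "f i = f' i" for i
        using ff[of i] M by (cases "i \<le> max M M'") auto
      then have "f = f'" by auto
      moreover have "g = g'"
        using eq \<open>f = f'\<close> by (auto simp: fun_eq_iff)
      ultimately show "f = f' \<and> g = g'" by simp
    qed
    show "?add ` (Flat K R \<times> ?Y) = ?Z"
    proof
      show "?add ` (Flat K R \<times> ?Y) \<subseteq> ?Z"
      proof clarify
        fix f g
        assume f: "f \<in> Flat K R" and g: "g \<in> Seqs" "\<forall>i. c dvd g i"
        have "step K R c (f i + g i) (f (Suc i) + g (Suc i))" for i
          unfolding step_def
        proof (intro bexI conjI)
          have "c dvd g j" for j using g by auto
          then show "[f i + g i = f i mod K] (mod c)"
            "[f (Suc i) + g (Suc i) = f (Suc i) mod K] (mod c)"
            using addc by auto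
          have "g (Suc i) \<le> g i" using g by (auto simp: Seqs_def antimono_def)
          then show "f (Suc i) + g (Suc i) + (f i mod K + K - f (Suc i) mod K) mod K \<le> f i + g i"
            using flat_diff[OF f, of i] by linarith
        qed (use f in \<open>auto simp: Flat_def\<close>)
        then show "(\<lambda>i. f i + g i) \<in> Seqs \<and>
            (\<forall>i. step K R c (f i + g i) (f (Suc i) + g (Suc i)))"
          using f g by (auto simp: Flat_def intro: Seqs_add)
      qed
      show "?Z \<subseteq> ?add ` (Flat K R \<times> ?Y)"
      proof clarify
        fix h assume h: "h \<in> Seqs" and st: "\<forall>i. step K R c (h i) (h (Suc i))"
        obtain N where N: "\<forall>i\<ge>N. h i = 0" using h by (auto simp: Seqs_def)
        have "\<forall>i. \<exists>r\<in>R. [h i = r] (mod c)" using st by (auto simp: step_def)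
        then obtain s where s: "\<And>i. s i \<in> R" "\<And>i. [h i = s i] (mod c)" by metis
        define d where "d i = (s i + K - s (Suc i)) mod K" for i
        have hd: "h (Suc i) + d i \<le> h i" for i
        proof -
          obtain r t where "r \<in> R" "t \<in> R" "[h i = r] (mod c)" "[h (Suc i) = t] (mod c)"
            "h (Suc i) + (r + K - t) mod K \<le> h i"
            using st unfolding step_def by blast
          moreover from this have "r = s i" "t = s (Suc i)"
            using s Rmod by (meson cong_sym cong_trans)+
          ultimately show ?thesis by (simp add: d_def)
        qed
        have s0: "s i = 0" if "i \<ge> N" for i
          using s[of i] N that R Rmod by (metis cong_sym)
        \<comment> \<open>The least differences allowed by the residues, telescoped from the end.\<close>
        define f where "f i = (\<Sum>j\<in>{i..<N}. d j)" for i
        have fN: "f i = 0" if "i \<ge> N" for i using that by (simp add: f_def)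
        have fS: "f i = d i + f (Suc i)" for i
        proof (cases "i < N")
          case True then show ?thesis by (simp add: f_def sum.atLeast_Suc_lessThan)
        next
          case False then show ?thesis using s0[of i] s0[of "Suc i"] by (simp add: fN d_def)
        qed
        have f_mod_le: "f i mod K = s i \<and> f i \<le> h i" if "i \<le> N" for i
          using that
        proof (induction i rule: inc_induct)
          case base then show ?case using fN s0 by simp
        next
          case (step i)
          have "s (Suc i) < K" using s R by auto
          have "f i mod K = (s i + K - s (Suc i) + s (Suc i)) mod K"
            using step.IH fS[of i] unfolding d_def by (metis mod_add_eq mod_mod_trivial)
          also have "\<dots> = s i" using \<open>s (Suc i) < K\<close> s Rself by simp
          finally show ?case using hd[of i] fS[of i] step.IH by auto
        qed
        have f: "f i mod K = s i" "f i \<le> h i" for i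
        proof -
          have "f i mod K = s i \<and> f i \<le> h i"
          proof (cases "i \<le> N")
            case True then show ?thesis by (rule f_mod_le)
          next
            case False
            then have "f i = 0" "s i = 0" using fN[of i] s0[of i] by simp_all
            then show ?thesis by simp
          qed
          then show "f i mod K = s i" "f i \<le> h i" by simp_all
        qed
        have fF: "f \<in> Flat K R"
        proof -
          have "f \<in> Seqs"
          proof (rule SeqsI)
            show "f (Suc i) \<le> f i" for i using fS[of i] by simp
          qed (rule fN)
          moreover have "f i mod K \<in> R \<and> f i < f (Suc i) + K" for i
            using f(1)[of i] s(1)[of i] fS[of i] K(2) by (simp add: d_def)
          ultimately show ?thesis by (simp add: Flat_def)
        qed
        define g where "g i = h i - f i" for i
        have "c dvd g i" for i
        proof -
          have "[h i = f i] (mod c)"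
            using s(2)[of i] modc[of "f i"] f(1)[of i] by (metis cong_trans)
          then show ?thesis using f(2)[of i]
            by (simp add: g_def cong_def mod_eq_dvd_iff_nat)
        qed
        moreover have "g \<in> Seqs"
        proof (rule SeqsI)
          show "g (Suc i) \<le> g i" for i using hd[of i] fS[of i] by (simp add: g_def)
          show "g i = 0" if "i \<ge> N" for i using that N by (simp add: g_def)
        qed
        moreover have "h = ?add (f, g)" using f by (auto simp: g_def)
        ultimately show "h \<in> ?add ` (Flat K R \<times> ?Y)"
          using fF by blast
      qed
    qed
  qed
  moreover have "finite {f \<in> Flat K R. weight f = n}" "finite {f \<in> ?Y. weight f = n}" for n
    using finite_Seqs_level[of n] by (auto simp: Flat_def elim: rev_finite_subset)
  moreover have "weight (?add (f, g)) = weight f + weight g" if "f \<in> Flat K R" "g \<in> ?Y" for f g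
    using that weight_add[of f g] by (simp add: Flat_def)
  ultimately have "gf weight ?Z = gf weight (Flat K R) * gf weight ?Y"
    by (intro gf_bij_Times[of _ weight _ weight ?add])
  then show ?thesis by (simp add: gf_Parts_eq_Seqs)
qed

section \<open>The conditions as conditions on sequences\<close>

definition local_S :: "nat \<Rightarrow> nat \<Rightarrow> nat \<Rightarrow> bool" where
  "local_S k a b \<longleftrightarrow>
     a - b \<noteq> 1 \<and>
     (a - b \<in> diffs2 k \<longrightarrow> \<not> [b = 1] (mod 3)) \<and>
     (a - b \<in> diffs4 k \<longrightarrow> [b = 0] (mod 3))"

lemma diffs2_iff: "d \<in> diffs2 k \<longleftrightarrow> d mod 3 = 2 \<and> d + 4 \<le> 3 * k"
proof
  assume "d mod 3 = 2 \<and> d + 4 \<le> 3 * k"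
  then have "d = 3 * (d div 3) + 2" "d div 3 < k - 1" by presburger+
  then show "d \<in> diffs2 k" unfolding diffs2_def by blast
next
  show "d \<in> diffs2 k \<Longrightarrow> d mod 3 = 2 \<and> d + 4 \<le> 3 * k"
    unfolding diffs2_def by (clarsimp, presburger)
qed

lemma diffs4_iff: "d \<in> diffs4 k \<longleftrightarrow> d mod 3 = 1 \<and> 4 \<le> d \<and> d + 2 \<le> 3 * k"
proof
  assume "d mod 3 = 1 \<and> 4 \<le> d \<and> d + 2 \<le> 3 * k"
  then have "d = 3 * (d div 3 - 1) + 4" "d div 3 - 1 < k - 1" by presburger+
  then show "d \<in> diffs4 k" unfolding diffs4_def by blast
next
  show "d \<in> diffs4 k \<Longrightarrow> d mod 3 = 1 \<and> 4 \<le> d \<and> d + 2 \<le> 3 * k"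
    unfolding diffs4_def by (clarsimp, presburger)
qed

lemma cond_S_iff_pad:
  assumes "is_partition xs"
  shows "cond_S k xs \<longleftrightarrow> (\<forall>i. local_S k (pad xs i) (pad xs (Suc i)))"
proof -
  have "(xs @ [0]) ! i = pad xs i" if "i \<le> length xs" for i
    using that by (auto simp: pad_def nth_append)
  then have "cond_S k xs \<longleftrightarrow> (\<forall>i<length xs. local_S k (pad xs i) (pad xs (Suc i)))"
    unfolding cond_S_fictitious_zero[OF assms] diff_conds_def local_S_def by simp
  moreover have "local_S k (pad xs i) (pad xs (Suc i))" if "\<not> i < length xs" for i
    using that by (simp add: local_S_def pad_def diffs2_iff diffs4_iff)
  ultimately show ?thesis by blast
qed

lemma residue_3_iff:
  assumes "r \<in> {0, 2, 4 :: nat}"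
  shows "[a = r] (mod 3) \<longleftrightarrow> r = (if a mod 3 = 0 then 0 else if a mod 3 = 1 then 4 else 2)"
  using assms by (auto simp: cong_def)

text \<open>With \<open>b\<close> in the class 0, 1, 2 modulo 3, the least difference is 4, \<open>K - 2\<close>, \<open>K - 2\<close> when it is
  congruent to 1, and 2, \<open>K - 4\<close>, 2 when it is congruent to 2. These are the gaps of (S): 1
  is excluded, and the progressions are those of the differences below \<open>K - 2\<close> and \<open>K - 4\<close>.\<close>

lemma step_3_iff:
  assumes "k \<ge> 1" "b \<le> a"
  shows "step (3 * k + 3) {0, 2, 4} 3 a b \<longleftrightarrow> local_S k a b"
proof -
  define \<rho> where "\<rho> x = (if x mod 3 = 0 then 0 else if x mod 3 = 1 then 4 else 2 :: nat)" for x :: nat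
  have \<rho>: "[x = r] (mod 3) \<longleftrightarrow> r = \<rho> x" if "r \<in> {0, 2, 4}" for x r
    unfolding \<rho>_def using that by (rule residue_3_iff)
  have \<rho>_in: "\<rho> x \<in> {0, 2, 4}" for x by (simp add: \<rho>_def)
  have step: "step (3 * k + 3) {0, 2, 4} 3 a b
      \<longleftrightarrow> b + (\<rho> a + (3 * k + 3) - \<rho> b) mod (3 * k + 3) \<le> a"
    (is "_ \<longleftrightarrow> ?T (\<rho> a) (\<rho> b)")
  proof
    show "?T (\<rho> a) (\<rho> b)" if "step (3 * k + 3) {0, 2, 4} 3 a b"
    proof -
      obtain r s where rs: "r \<in> {0, 2, 4}" "s \<in> {0, 2, 4}"
        "[a = r] (mod 3)" "[b = s] (mod 3)" "?T r s"
        using \<open>step _ _ _ _ _\<close> unfolding step_def by blast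
      have "r = \<rho> a" "s = \<rho> b" using \<rho>[OF rs(1)] \<rho>[OF rs(2)] rs(3,4) by blast+
      with rs(5) show ?thesis by simp
    qed
    show "step (3 * k + 3) {0, 2, 4} 3 a b" if "?T (\<rho> a) (\<rho> b)"
      unfolding step_def using that \<rho>[OF \<rho>_in] \<rho>_in
      by (intro bexI[of _ "\<rho> a"] bexI[of _ "\<rho> b"] conjI) (assumption | simp)+
  qed
  define d where "d = a - b"
  have a: "a = b + d" using assms by (simp add: d_def)
  define w where "w = (\<rho> a + (3 * k + 3) - \<rho> b) mod (3 * k + 3)"
  have w: "w = (if \<rho> b \<le> \<rho> a then \<rho> a - \<rho> b else \<rho> a + (3 * k + 3) - \<rho> b)"
  proof (cases "\<rho> b \<le> \<rho> a")
    case True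
    then have "w = (\<rho> a - \<rho> b + (3 * k + 3)) mod (3 * k + 3)" by (simp add: w_def)
    also have "\<dots> = (\<rho> a - \<rho> b) mod (3 * k + 3)" by (rule mod_add_self2)
    also have "\<dots> = \<rho> a - \<rho> b" using \<rho>_in[of a] assms by (intro mod_less) auto
    finally show ?thesis using True by simp
  qed (auto simp: w_def)
  have "a mod 3 = (b mod 3 + d mod 3) mod 3" by (simp add: a mod_add_eq)
  moreover have "b mod 3 = 0 \<or> b mod 3 = 1 \<or> b mod 3 = 2" "d mod 3 = 0 \<or> d mod 3 = 1 \<or> d mod 3 = 2"
    by presburger+
  ultimately have table: "w = (if d mod 3 = 0 then 0
      else if d mod 3 = 2 then (if b mod 3 = 1 then 3 * k - 1 else 2)
      else (if b mod 3 = 0 then 4 else 3 * k + 1))"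
    by (elim disjE) (simp_all add: w \<rho>_def)
  have "local_S k a b \<longleftrightarrow> d \<noteq> 1 \<and>
      (d mod 3 = 2 \<and> d + 4 \<le> 3 * k \<longrightarrow> b mod 3 \<noteq> 1) \<and>
      (d mod 3 = 1 \<and> 4 \<le> d \<and> d + 2 \<le> 3 * k \<longrightarrow> b mod 3 = 0)"
    by (simp add: local_S_def diffs2_iff diffs4_iff d_def cong_def)
  also have "\<dots> \<longleftrightarrow> w \<le> d"
  proof -
    define e where "e = d div 3"
    have de: "d = 3 * e + d mod 3" by (simp add: e_def)
    consider "d mod 3 = 0" | "d mod 3 = 1" | "d mod 3 = 2" by linarith
    then show ?thesis
    proof cases
      case 1
      then show ?thesis unfolding table by auto
    next
      case 2
      have "4 \<le> d \<longleftrightarrow> d \<noteq> 1" "\<not> (4 \<le> d \<and> d + 2 \<le> 3 * k) \<longleftrightarrow> d = 1 \<or> 3 * k + 1 \<le> d" "\<not> 3 * k + 1 \<le> 1"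
        using de assms(1) unfolding 2 by presburger+
      with 2 show ?thesis unfolding table by auto
    next
      case 3
      have "2 \<le> d" "\<not> d + 4 \<le> 3 * k \<longleftrightarrow> 3 * k - 1 \<le> d"
        using de assms(1) unfolding 3 by presburger+
      with 3 show ?thesis unfolding table by auto
    qed
  qed
  finally show ?thesis using step by (simp add: a w_def)
qed

text \<open>For \<open>c = K\<close> the bound is the residue of the difference itself, so it always holds.\<close>

lemma step_self_iff:
  assumes "R \<subseteq> {..<K}" "b \<le> a"
  shows "step K R K a b \<longleftrightarrow> a mod K \<in> R \<and> b mod K \<in> R"
proof
  have r: "r mod K = r" if "r \<in> R" for r using assms that by auto
  show "a mod K \<in> R \<and> b mod K \<in> R" if "step K R K a b"
    using that r unfolding step_def cong_def by metis
  assume R: "a mod K \<in> R \<and> b mod K \<in> R"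
  then have "K > 0" using assms by auto
  then have "b + (a mod K + K - b mod K) mod K \<le> a"
    using diff_of_residues[of K b a] assms(2) mod_less_eq_dividend[of "a - b" K] by linarith
  then show "step K R K a b"
    using R unfolding step_def cong_def by (metis mod_mod_trivial)
qed

lemma gf_S:
  assumes "k \<ge> 1"
  shows "gf sum_list {xs. is_partition xs \<and> cond_S k xs}
    = gf weight (Flat (3 * k + 3) {0, 2, 4}) * gf_Parts {m. 3 dvd m}"
proof -
  have "{xs. is_partition xs \<and> cond_S k xs}
      = {xs. is_partition xs \<and> (\<forall>i. step (3 * k + 3) {0, 2, 4} 3 (pad xs i) (pad xs (Suc i)))}"
    using step_3_iff[OF assms] cond_S_iff_pad pad_antimono by (metis (lifting) lessI less_imp_le)
  then show ?thesis
    using assms by (simp only: gf_pad[of "\<lambda>f. \<forall>i. step _ _ _ (f i) (f (Suc i))"])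
      (intro gf_split, auto simp: inj_on_def)
qed

lemma gf_three_residues:
  assumes "k \<ge> 1"
  shows "gf_Parts {m. m mod (3 * k + 3) \<in> {0, 2, 4}}
    = gf weight (Flat (3 * k + 3) {0, 2, 4}) * gf_Parts {m. (3 * k + 3) dvd m}"
proof -
  let ?K = "3 * k + 3" and ?R = "{0, 2, 4} :: nat set"
  have R: "?R \<subseteq> {..<?K}" using assms by auto
  have "gf_Parts {m. m mod ?K \<in> ?R} = gf weight {f \<in> Seqs. \<forall>i. f i mod ?K \<in> ?R}"
    by (rule gf_Parts_eq_Seqs) simp
  also have "{f \<in> Seqs. \<forall>i. f i mod ?K \<in> ?R} = {f \<in> Seqs. \<forall>i. step ?K ?R ?K (f i) (f (Suc i))}"
  proof (intro Collect_cong conj_cong refl)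
    fix f assume "f \<in> Seqs"
    then have "f (Suc i) \<le> f i" for i by (auto simp: Seqs_def antimono_def)
    then show "(\<forall>i. f i mod ?K \<in> ?R) \<longleftrightarrow> (\<forall>i. step ?K ?R ?K (f i) (f (Suc i)))"
      using step_self_iff[OF R] by blast
  qed
  also have "gf weight \<dots> = gf weight (Flat ?K ?R) * gf_Parts {m. ?K dvd m}"
    using R by (intro gf_split) (auto simp: inj_on_def)
  finally show ?thesis .
qed

lemma allowed_part_iff:
  assumes "k \<ge> 1"
  shows "allowed_part k m \<longleftrightarrow> 3 dvd m \<or> m mod (3 * k + 3) \<in> {2, 4}"
  using assms by (auto simp: allowed_part_def cong_def mod_if)

lemma gf_P_eq_gf_S:
  assumes "k \<ge> 1"
  shows "gf_Parts {m. allowed_part k m} = gf sum_list {xs. is_partition xs \<and> cond_S k xs}"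
proof -
  let ?K = "3 * k + 3"
  let ?D = "gf_Parts {m. ?K dvd m}" and ?T = "gf_Parts {m. 3 dvd m}"
  let ?A = "gf_Parts {m. m mod ?K \<in> {2, 4}}"
  have "m mod ?K mod 3 = m mod 3" for m by (simp add: mod_mod_cancel)
  then have "\<not> 3 dvd m" if "m mod ?K \<in> {2, 4}" for m
    using that by (auto simp: dvd_eq_mod_eq_0 dest: arg_cong[of _ _ "\<lambda>x. x mod 3"])
  then have disj: "{m. m mod ?K \<in> {2, 4}} \<inter> {m. 3 dvd m} = {}" by blast
  have "{m. allowed_part k m} = {m. m mod ?K \<in> {2, 4}} \<union> {m. 3 dvd m}"
    using allowed_part_iff[OF assms] by auto
  then have P: "gf_Parts {m. allowed_part k m} = ?A * ?T"
    using gf_Parts_Un[OF disj] by simp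
  have "{m. m mod ?K \<in> {0, 2, 4}} = {m. m mod ?K \<in> {2, 4}} \<union> {m. ?K dvd m}"
    by (auto simp: dvd_eq_mod_eq_0)
  then have "?A * ?D = gf_Parts {m. m mod ?K \<in> {0, 2, 4}}"
    by (simp only:) (rule gf_Parts_Un[symmetric], auto simp: dvd_eq_mod_eq_0)
  also have "\<dots> = gf weight (Flat ?K {0, 2, 4}) * ?D"
    by (rule gf_three_residues[OF assms])
  \<comment> \<open>Cancelling the multiples of \<open>K\<close> is the only step that is not bijective.\<close>
  finally have "?A = gf weight (Flat ?K {0, 2, 4})"
    using gf_Parts_nonzero by simp
  then show ?thesis using P gf_S[OF assms] by simp
qed

section \<open>Conjugation\<close>

text \<open>Parts of the conjugate are columns: those longer than \<open>v\<close> are counted by row \<open>v\<close>.\<close>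

lemma length_filter_conjugate:
  assumes "is_partition xs"
  shows "length (filter (\<lambda>y. y > v) (conjugate xs)) = pad xs v"
proof -
  have "{j. j < length (conjugate xs) \<and> v < conjugate xs ! j} = {j. (j, v) \<in> ferrers (conjugate xs)}"
    by (auto simp: ferrers_def)
  also have "\<dots> = {j. (v, j) \<in> ferrers xs}"
    using conjugate[OF assms] by auto
  also have "\<dots> = {..<pad xs v}"
    by (auto simp: ferrers_def pad_def split: if_splits)
  finally show ?thesis by (simp add: length_filter_conv_card)
qed

lemma count_list_conjugate:
  assumes "is_partition xs"
  shows "count_list (conjugate xs) (Suc v) = pad xs v - pad xs (Suc v)"
proof -
  have "length (filter (\<lambda>y. y > v) ys)
      = length (filter (\<lambda>y. y > Suc v) ys) + count_list ys (Suc v)" for ys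
    by (induction ys) auto
  from this[of "conjugate xs"] show ?thesis
    using length_filter_conjugate[OF assms] by simp
qed

lemma cond_S_iff_cond_C_conjugate:
  assumes "is_partition xs"
  shows "cond_S k xs \<longleftrightarrow> cond_C k (conjugate xs)"
proof -
  let ?ys = "conjugate xs"
  have pos: "x > 0" if "x \<in> set ?ys" for x
    using conjugate[OF assms] that by (auto simp: is_partition_def)
  \<comment> \<open>A value that does not occur in the conjugate is a difference 0, on which (S) puts no condition.\<close>
  have triv: "local_S k (pad xs v) (pad xs (Suc v))" if "Suc v \<notin> set ?ys" for v
  proof -
    have "pad xs v - pad xs (Suc v) = 0"
      using that count_list_conjugate[OF assms, of v] by (metis count_notin)
    then show ?thesis by (simp add: local_S_def diffs2_iff diffs4_iff)
  qed
  have "cond_C k ?ys \<longleftrightarrow> (\<forall>v. Suc v \<in> set ?ys \<longrightarrow> local_S k (pad xs v) (pad xs (Suc v)))"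
    (is "_ \<longleftrightarrow> ?R")
  proof -
    have "cond_C k ?ys \<longleftrightarrow> (\<forall>x\<in>set ?ys. local_S k (pad xs (x - 1)) (pad xs x))"
      unfolding cond_C_def
    proof (rule ball_cong[OF refl])
      fix x assume "x \<in> set ?ys"
      then obtain v where "x = Suc v" using pos gr0_conv_Suc by blast
      then show "(count_list ?ys x \<noteq> 1 \<and>
          (count_list ?ys x \<in> diffs2 k \<longrightarrow> \<not> [length (filter (\<lambda>y. y > x) ?ys) = 1] (mod 3)) \<and>
          (count_list ?ys x \<in> diffs4 k \<longrightarrow> [length (filter (\<lambda>y. y > x) ?ys) = 0] (mod 3)))
        \<longleftrightarrow> local_S k (pad xs (x - 1)) (pad xs x)"
        by (simp add: local_S_def count_list_conjugate[OF assms] length_filter_conjugate[OF assms])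
    qed
    also have "\<dots> \<longleftrightarrow> ?R"
      using pos by (metis Suc_pred' diff_Suc_1)
    finally show ?thesis .
  qed
  then show ?thesis
    using cond_S_iff_pad[OF assms] triv by blast
qed

theorem mainTheorem3:
  fixes k :: nat
  assumes "k \<ge> 1"
  shows "(\<forall>n. card {xs \<in> partitions_of n. cond_P k xs} = card {xs \<in> partitions_of n. cond_S k xs})
    \<and> (\<lambda>m. if allowed_part k (Suc m) then inverse (1 - fps_X ^ Suc m) else 1) has_prod gf_P k
    \<and> (\<forall>m. allowed_part k (m + (3 * k + 3)) \<longleftrightarrow> allowed_part k m)
    \<and> (\<forall>xs. is_partition xs \<longrightarrow> (cond_S k xs \<longleftrightarrow> cond_C k (conjugate xs)))"
proof (intro conjI allI impI)
  have P: "gf_P k = gf_Parts {m. allowed_part k m}"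
    by (auto simp: gf_P_def gf_def Parts_def partitions_of_def cond_P_def
        intro!: fps_ext arg_cong[where f = card])
  show "(\<lambda>m. if allowed_part k (Suc m) then inverse (1 - fps_X ^ Suc m) else 1) has_prod gf_P k"
    using gf_Parts_has_prod[of "{m. allowed_part k m}"] by (simp add: P)
  fix n
  have "{xs \<in> {xs. is_partition xs \<and> cond_S k xs}. sum_list xs = n}
      = {xs \<in> partitions_of n. cond_S k xs}"
    by (auto simp: partitions_of_def)
  moreover have "gf_P k = gf sum_list {xs. is_partition xs \<and> cond_S k xs}"
    using P gf_P_eq_gf_S[OF assms] by simp
  ultimately have "fps_nth (gf_P k) n = of_nat (card {xs \<in> partitions_of n. cond_S k xs})"
    by (simp add: gf_def)
  then show "card {xs \<in> partitions_of n. cond_P k xs} = card {xs \<in> partitions_of n. cond_S k xs}"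
    by (simp add: gf_P_def)
next
  fix m
  have "3 dvd (m + (3 * k + 3)) \<longleftrightarrow> 3 dvd m" by presburger
  then show "allowed_part k (m + (3 * k + 3)) \<longleftrightarrow> allowed_part k m"
    by (simp add: allowed_part_def cong_def)
next
  fix xs :: "nat list"
  assume "is_partition xs"
  then show "cond_S k xs \<longleftrightarrow> cond_C k (conjugate xs)"
    by (rule cond_S_iff_cond_C_conjugate)
qed

end
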